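(* Let $A=A_s+A_d\varepsilon$ be an $n\times n$ primitive dual number matrix with Perron eigenvalue $\lambda=\lambda_s+\lambda_d\varepsilon\in\mathbb{D}_{++}$. Let $\mathbf{x}^0\in\mathbb{R}^n_{++}$ be an arbitrary real vector with all entries positive, put $\mathbf{y}^0=A\mathbf{x}^0$, and for $k=0,1,2,\ldots$ define $$\mathbf{x}^{k+1}=\frac{\mathbf{y}^k}{\|\mathbf{y}^k\|_2},\qquad \mathbf{y}^{k+1}=A\mathbf{x}^{k+1},\qquad \underline{\lambda}_k=\min_{1\le i\le n}\frac{(A\mathbf{x}^k)_i}{x^k_i},\qquad \overline{\lambda}_k=\max_{1\le i\le n}\frac{(A\mathbf{x}^k)_i}{x^k_i},$$ where the min and max are taken with respect to the total order on dual numbers. Then $$\lim_{k\to\infty}\left(\overline{\lambda}_k-\underline{\lambda}_k\right)=0.$$ Moreover, the convergence rate of the dual number sequence $\{\overline{\lambda}_k-\underline{\lambda}_k\}$ is $R$-linear, i.e., there exist constants $\tilde{\Delta}>0$ and $\eta\in(0,1)$ such that, for all sufficiently large $k$, the absolute values of both the standard part and the dual part of $\overline{\lambda}_k-\underline{\lambda}_k$ are at most $\tilde{\Delta}\eta^k$.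
   Context: The symbol $\varepsilon$ is the infinitesimal unit: it commutes with real numbers and satisfies $\varepsilon\neq0$, $\varepsilon^2=0$. A dual number is $a=a_s+a_d\varepsilon$ with standard part $a_s\in\mathbb{R}$ and dual part $a_d\in\mathbb{R}$; $\mathbb{D}$ is the set of dual numbers, with $a+b=(a_s+b_s)+(a_d+b_d)\varepsilon$ and $ab=a_sb_s+(a_sb_d+a_db_s)\varepsilon$. Order: $a>b$ if $a_s>b_s$, or $a_s=b_s$ and $a_d>b_d$ (lexicographic total order). $\mathbb{D}_{++}$ is the set of dual numbers $>0$. Division: if $b_s\ne0$, then $\frac{a_s+a_d\varepsilon}{b_s+b_d\varepsilon}=\frac{a_s}{b_s}+\left(\frac{a_d}{b_s}-\frac{a_sb_d}{b_s^2}\right)\varepsilon$. A sequence of dual numbers converges to $0$ if both its standard parts and its dual parts converge to $0$ in $\mathbb{R}$. Norm: for a dual number vector $\mathbf{x}=\mathbf{x}_s+\mathbf{x}_d\varepsilon$ ($\mathbf{x}_s,\mathbf{x}_d\in\mathbb{R}^n$) with $\mathbf{x}_s\neq\mathbf{0}$, $\|\mathbf{x}\|_2=\|\mathbf{x}_s\|_2+\frac{\mathbf{x}_s^T\mathbf{x}_d}{\|\mathbf{x}_s\|_2}\varepsilon$, and $\mathbf{x}/\|\mathbf{x}\|_2$ is obtained by entrywise division, i.e. it has standard part $\frac{\mathbf{x}_s}{\|\mathbf{x}_s\|_2}$ and dual part $\frac{\mathbf{x}_d}{\|\mathbf{x}_s\|_2}-\frac{\mathbf{x}_s}{\|\mathbf{x}_s\|_2}\frac{\mathbf{x}_s^T\mathbf{x}_d}{\|\mathbf{x}_s\|_2^2}$.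 In the iteration all vectors $\mathbf{x}^k,\mathbf{y}^k$ have entrywise positive standard parts, so all norms and divisions are of this kind. A dual number matrix $A=A_s+A_d\varepsilon\in\mathbb{D}^{n\times n}$ ($A_s,A_d\in\mathbb{R}^{n\times n}$) is primitive if $A_s$ is a primitive matrix, i.e. $A_s\ge O$ entrywise and there is a positive integer $k$ with $A_s^k>O$ entrywise. An eigenvalue of $A$ is a dual complex number $\lambda=\lambda_s+\lambda_d\varepsilon$ ($\lambda_s,\lambda_d\in\mathbb{C}$) for which there is a vector $\mathbf{x}=\mathbf{x}_s+\mathbf{x}_d\varepsilon$ ($\mathbf{x}_s,\mathbf{x}_d\in\mathbb{C}^n$, $\mathbf{x}_s\ne\mathbf{0}$) with $A\mathbf{x}=\lambda\mathbf{x}$. It is known that a primitive dual number matrix $A$ has an eigenvalue $\lambda=\lambda_s+\lambda_d\varepsilon\in\mathbb{D}_{++}$ with an eigenvector in $\mathbb{D}_{++}^n$, where $\lambda_s$ is the (simple) Perron eigenvalue $\rho(A_s)$ of $A_s$ and $\lambda_d=\frac{\mathbf{y}_s^TA_d\mathbf{x}_s}{\mathbf{y}_s^T\mathbf{x}_s}$, with $\mathbf{x}_s$ and $\mathbf{y}_s$ the Perron eigenvectors of $A_s$ and $A_s^T$; this $\lambda$ is called the Perron eigenvalue of $A$. *)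

theory Defs
  imports "HOL-Analysis.Analysis"
begin

subsection \<open>Dual numbers\<close>

text \<open>\<open>Dual a b\<close> stands for \<open>a + b \<epsilon>\<close>. The type is polymorphic so that it covers both dual
  (real) numbers, \<open>real dual_number\<close>, and dual complex numbers, \<open>complex dual_number\<close>.\<close>

datatype 'a dual_number = Dual (std_part: 'a) (dual_part: 'a)

instantiation dual_number :: (comm_ring_1) comm_ring_1
begin

definition "0 = Dual 0 0"
definition "1 = Dual 1 0"
definition "a + b = Dual (std_part a + std_part b) (dual_part a + dual_part b)"
definition "a - b = Dual (std_part a - std_part b) (dual_part a - dual_part b)"
definition "- a = Dual (- std_part a) (- dual_part a)"
definition "a * b = Dual (std_part a * std_part b)
  (std_part a * dual_part b + dual_part a * std_part b)"

instance
  by standard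
    (simp_all add: zero_dual_number_def one_dual_number_def plus_dual_number_def
      minus_dual_number_def uminus_dual_number_def times_dual_number_def algebra_simps)

end

text \<open>Lexicographic order.\<close>

instantiation dual_number :: (linorder) linorder
begin

definition "a < b \<longleftrightarrow>
  std_part a < std_part b \<or> std_part a = std_part b \<and> dual_part a < dual_part b"
definition "a \<le> b \<longleftrightarrow> a = b \<or> a < (b :: 'a dual_number)"

instance
proof
  fix a b :: "'a dual_number"
  show "a \<le> b \<or> b \<le> a"
    using less_linear[of "std_part a" "std_part b"] less_linear[of "dual_part a" "dual_part b"]
    by (auto simp: less_dual_number_def less_eq_dual_number_def intro: dual_number.expand)
qed (auto simp: less_dual_number_def less_eq_dual_number_def)

end

text \<open>Division is meaningful only for divisors with nonzero standard part.\<close>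

instantiation dual_number :: (field) inverse
begin

definition "a div b = Dual (std_part a / std_part b)
  (dual_part a / std_part b - std_part a * dual_part b / (std_part b)\<^sup>2)"
definition "inverse a = 1 div (a :: 'a dual_number)"

instance ..

end

lemma dual_number_divide_mult:
  fixes a b :: "'a :: field dual_number"
  assumes "std_part b \<noteq> 0"
  shows "a / b * b = a"
  using assms
  by (cases a; cases b)
    (simp add: divide_dual_number_def times_dual_number_def field_simps power2_eq_square)

definition dual_eps :: "'a :: comm_ring_1 dual_number" where
  "dual_eps = Dual 0 1"

lemma dual_eps_square: "dual_eps * dual_eps = 0"
  by (simp add: dual_eps_def times_dual_number_def zero_dual_number_def)

lemma dual_number_decompose: "Dual a b = Dual a 0 + Dual b 0 * dual_eps"
  by (simp add: dual_eps_def times_dual_number_def plus_dual_number_def)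

definition dual_tendsto :: "(nat \<Rightarrow> real dual_number) \<Rightarrow> real dual_number \<Rightarrow> bool" where
  "dual_tendsto X L \<longleftrightarrow>
    (\<lambda>k. std_part (X k)) \<longlonglongrightarrow> std_part L \<and> (\<lambda>k. dual_part (X k)) \<longlonglongrightarrow> dual_part L"


subsection \<open>Dual number vectors and matrices\<close>

definition map_vector :: "('a \<Rightarrow> 'b) \<Rightarrow> 'a ^ 'n \<Rightarrow> 'b ^ 'n" where
  "map_vector f x = (\<chi> i. f (x $ i))"

text \<open>The 2-norm of a dual number vector whose standard part is nonzero.\<close>

definition dual_norm :: "real dual_number ^ 'n \<Rightarrow> real dual_number" where
  "dual_norm x =
    (let xs = map_vector std_part x; xd = map_vector dual_part x
     in Dual (norm xs) (xs \<bullet> xd / norm xs))"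

definition dual_normalize :: "real dual_number ^ 'n \<Rightarrow> real dual_number ^ 'n" where
  "dual_normalize x = (\<chi> i. x $ i / dual_norm x)"

text \<open>Matrix powers have to be written out as iterated \<open>**\<close>: the operation \<open>*\<close> on the
  type \<open>_ ^ 'n ^ 'n\<close>, and hence \<open>^\<close>, is componentwise.\<close>

definition matrix_power :: "real ^ 'n ^ 'n \<Rightarrow> nat \<Rightarrow> real ^ 'n ^ 'n" where
  "matrix_power M k = (((**) M) ^^ k) (mat 1)"

definition primitive_matrix :: "real ^ 'n ^ 'n \<Rightarrow> bool" where
  "primitive_matrix M \<longleftrightarrow>
    (\<forall>i j. 0 \<le> M $ i $ j) \<and> (\<exists>k>0. \<forall>i j. 0 < matrix_power M k $ i $ j)"

definition dual_primitive_matrix :: "real dual_number ^ 'n ^ 'n \<Rightarrow> bool" where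
  "dual_primitive_matrix A \<longleftrightarrow> primitive_matrix (map_matrix std_part A)"


subsection \<open>Eigenvalues\<close>

definition spectral_radius :: "real ^ 'n ^ 'n \<Rightarrow> real" where
  "spectral_radius M =
    Max (cmod ` {\<mu>. \<exists>v. v \<noteq> 0 \<and> map_matrix complex_of_real M *v v = \<mu> *s v})"

definition perron_eigenvector :: "real ^ 'n ^ 'n \<Rightarrow> real ^ 'n \<Rightarrow> bool" where
  "perron_eigenvector M x \<longleftrightarrow> (\<forall>i. 0 < x $ i) \<and> M *v x = spectral_radius M *s x"

abbreviation dual_complex :: "real dual_number \<Rightarrow> complex dual_number" where
  "dual_complex \<equiv> map_dual_number complex_of_real"

definition dual_eigenpair ::
  "real dual_number ^ 'n ^ 'n \<Rightarrow> complex dual_number \<Rightarrow> complex dual_number ^ 'n \<Rightarrow> bool" where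
  "dual_eigenpair A l x \<longleftrightarrow>
    map_vector std_part x \<noteq> 0 \<and> map_matrix dual_complex A *v x = l *s x"

text \<open>The Perron eigenvalue of a primitive dual number matrix: the positive dual number
  eigenvalue with an entrywise positive eigenvector whose standard part is the Perron
  eigenvalue of \<open>A\<^sub>s\<close> and whose dual part is \<open>y\<^sub>s\<^sup>T A\<^sub>d x\<^sub>s / y\<^sub>s\<^sup>T x\<^sub>s\<close>. Since Perron
  eigenvectors are unique up to positive scaling, the quotient does not depend on the choice
  of \<open>x\<^sub>s\<close> and \<open>y\<^sub>s\<close>.\<close>

definition dual_perron_eigenvalue ::
  "real dual_number ^ 'n ^ 'n \<Rightarrow> real dual_number \<Rightarrow> bool" where
  "dual_perron_eigenvalue A l \<longleftrightarrow>
    0 < l \<and>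
    (\<exists>x. (\<forall>i. 0 < x $ i) \<and> dual_eigenpair A (dual_complex l) (map_vector dual_complex x)) \<and>
    std_part l = spectral_radius (map_matrix std_part A) \<and>
    (\<exists>xs ys. perron_eigenvector (map_matrix std_part A) xs \<and>
      perron_eigenvector (transpose (map_matrix std_part A)) ys \<and>
      dual_part l = (ys \<bullet> (map_matrix dual_part A *v xs)) / (ys \<bullet> xs))"


subsection \<open>Collatz bounds\<close>

definition collatz_lower :: "real dual_number ^ 'n ^ 'n \<Rightarrow> real dual_number ^ 'n \<Rightarrow> real dual_number"
  where "collatz_lower A x = Min (range (\<lambda>i. (A *v x) $ i / x $ i))"

definition collatz_upper :: "real dual_number ^ 'n ^ 'n \<Rightarrow> real dual_number ^ 'n \<Rightarrow> real dual_number"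
  where "collatz_upper A x = Max (range (\<lambda>i. (A *v x) $ i / x $ i))"

end

theory Submission
  imports Defs
begin

text \<open>Let \<open>u\<close> be the positive eigenvector of \<open>A\<close> and put \<open>w\<^sub>i = (A\<^sup>k x\<^sup>0)\<^sub>i / (\<lambda>\<^sup>k u\<^sub>i)\<close>. Passing
  from \<open>k\<close> to \<open>k + m\<close> multiplies \<open>w\<close> by a dual matrix \<open>Q\<close> whose rows sum to \<open>1\<close>: its standard part
  is stochastic, and positive for suitable \<open>m\<close>, while the rows of its dual part sum to \<open>0\<close>. Hence
  the oscillation of the standard part of \<open>w\<close> contracts, and that of the dual part contracts up to
  a multiple of the oscillation of the standard part, so a weighted sum of both decays
  geometrically. The Collatz quotients do not change when the vector is scaled, and they differ
  from \<open>\<lambda>\<close> by \<open>\<lambda> (Q w - w)\<^sub>i / w\<^sub>i\<close> with \<open>m = 1\<close>, which is bounded by these oscillations.\<close>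

section \<open>Arithmetic of dual numbers\<close>

lemma std_part_simps [simp]:
  fixes a b :: "'a :: comm_ring_1 dual_number"
  shows "std_part (0 :: 'a dual_number) = 0" "std_part (1 :: 'a dual_number) = 1"
    "std_part (a + b) = std_part a + std_part b" "std_part (a - b) = std_part a - std_part b"
    "std_part (a * b) = std_part a * std_part b"
  by (simp_all add: zero_dual_number_def one_dual_number_def plus_dual_number_def
      minus_dual_number_def times_dual_number_def)

lemma dual_part_simps [simp]:
  fixes a b :: "'a :: comm_ring_1 dual_number"
  shows "dual_part (0 :: 'a dual_number) = 0" "dual_part (1 :: 'a dual_number) = 0"
    "dual_part (a + b) = dual_part a + dual_part b" "dual_part (a - b) = dual_part a - dual_part b"
    "dual_part (a * b) = std_part a * dual_part b + dual_part a * std_part b"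
  by (simp_all add: zero_dual_number_def one_dual_number_def plus_dual_number_def
      minus_dual_number_def times_dual_number_def)

lemma std_part_inverse [simp]: "std_part (inverse a) = inverse (std_part a :: 'a :: field)"
  by (simp add: inverse_dual_number_def divide_dual_number_def divide_inverse)

lemma std_part_sum: "std_part (sum f S) = (\<Sum>i\<in>S. std_part (f i :: 'a :: comm_ring_1 dual_number))"
  by (induction S rule: infinite_finite_induct) auto

lemma dual_part_sum: "dual_part (sum f S) = (\<Sum>i\<in>S. dual_part (f i :: 'a :: comm_ring_1 dual_number))"
  by (induction S rule: infinite_finite_induct) auto

lemma std_part_power: "std_part (a ^ k) = std_part (a :: 'a :: comm_ring_1 dual_number) ^ k"
  by (induction k) auto

text \<open>If \<open>b\<close> has standard part zero, both sides are \<open>0\<close> by the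
  convention for division by zero.\<close>

lemma dual_divide_inverse: "a / b = a * inverse (b :: 'a :: field dual_number)"
  by (rule dual_number.expand)
    (simp add: inverse_dual_number_def divide_dual_number_def divide_inverse algebra_simps)

lemma dual_inverse_mult: "std_part b \<noteq> 0 \<Longrightarrow> inverse b * b = (1 :: 'a :: field dual_number)"
  using dual_number_divide_mult[of b 1] by (simp add: inverse_dual_number_def)

lemma dual_divide_eqI: "std_part b \<noteq> 0 \<Longrightarrow> a = c * b \<Longrightarrow> a / b = (c :: 'a :: field dual_number)"
  using dual_inverse_mult[of b] by (simp add: dual_divide_inverse mult.assoc mult.commute[of b])

text \<open>The error of a Collatz quotient will have the form \<open>l * (a / b)\<close> with
  \<open>a\<close> small. The dual part of \<open>a / b\<close> contains \<open>dual_part b\<close>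
  over a square of \<open>std_part b\<close>, so \<open>b\<close> is controlled from below in its
  standard part and in absolute value in its dual part. Both bounds are linear in \<open>t\<close>,
  hence inherit its decay.\<close>

lemma dual_mult_divide_bounds:
  fixes a b l :: "real dual_number"
  assumes "\<bar>std_part a\<bar> \<le> t" "\<bar>dual_part a\<bar> \<le> t" "\<mu> \<le> std_part b" "0 < \<mu>" "\<bar>dual_part b\<bar> \<le> B"
  shows "\<bar>std_part (l * (a / b))\<bar> \<le> (\<bar>std_part l\<bar> / \<mu>) * t"
    and "\<bar>dual_part (l * (a / b))\<bar> \<le>
      (\<bar>std_part l\<bar> * (1 / \<mu> + B / \<mu>\<^sup>2) + \<bar>dual_part l\<bar> / \<mu>) * t"
proof -
  have t: "0 \<le> t" using assms(1) by linarith
  have s: "\<bar>std_part a / std_part b\<bar> \<le> t / \<mu>" and d: "\<bar>dual_part a / std_part b\<bar> \<le> t / \<mu>"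
    using assms t by (auto intro!: frac_le)
  have e: "\<bar>std_part a * dual_part b / (std_part b)\<^sup>2\<bar> \<le> t * B / \<mu>\<^sup>2"
    unfolding abs_divide abs_mult using assms t
    by (intro frac_le mult_mono power_mono) (auto simp: power_mono)
  have de: "\<bar>dual_part a / std_part b - std_part a * dual_part b / (std_part b)\<^sup>2\<bar>
      \<le> t / \<mu> + t * B / \<mu>\<^sup>2"
    using d e by linarith
  show "\<bar>std_part (l * (a / b))\<bar> \<le> (\<bar>std_part l\<bar> / \<mu>) * t"
    using mult_left_mono[OF s, of "\<bar>std_part l\<bar>"]
    by (simp add: divide_dual_number_def abs_mult)
  have "\<bar>dual_part (l * (a / b))\<bar> \<le> \<bar>std_part l\<bar> * (t / \<mu> + t * B / \<mu>\<^sup>2) + \<bar>dual_part l\<bar> * (t / \<mu>)"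
    using mult_left_mono[OF de, of "\<bar>std_part l\<bar>"] mult_left_mono[OF s, of "\<bar>dual_part l\<bar>"]
    unfolding divide_dual_number_def dual_part_simps dual_number.sel
    by (intro order_trans[OF abs_triangle_ineq] add_mono) (simp_all add: abs_mult)
  then show "\<bar>dual_part (l * (a / b))\<bar> \<le>
      (\<bar>std_part l\<bar> * (1 / \<mu> + B / \<mu>\<^sup>2) + \<bar>dual_part l\<bar> / \<mu>) * t"
    by (simp add: algebra_simps)
qed

section \<open>Matrix powers and orbits of vectors\<close>

lemma matrix_vector_component:
  "(A *v x) $ i = (\<Sum>j\<in>UNIV. A $ i $ j * x $ j)"
  by (simp add: matrix_vector_mult_def)

lemma matrix_vector_smult:
  fixes M :: "'a :: comm_ring_1 ^ 'n ^ 'm"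
  shows "M *v (c *s v) = c *s (M *v v)"
  by (simp add: vec_eq_iff matrix_vector_component sum_distrib_left mult.left_commute)

text \<open>Links the matrix power, whose entries primitivity makes positive, with the orbit of a
  vector.\<close>

lemma matrix_vector_funpow:
  fixes M :: "'a :: comm_ring_1 ^ 'n ^ 'n"
  shows "(((**) M) ^^ k) (mat 1) *v v = ((*v) M ^^ k) v"
  by (induction k) (simp_all flip: matrix_vector_mul_assoc)

text \<open>Taking standard parts is a ring homomorphism, so it commutes with matrix products. This
  carries primitivity over to the powers of \<open>A\<close> itself.\<close>

lemma std_part_matrix_power:
  fixes A :: "real dual_number ^ 'n ^ 'n"
  shows "std_part ((((**) A) ^^ k) (mat 1) $ i $ j) = matrix_power (map_matrix std_part A) k $ i $ j"
proof (induction k arbitrary: i j)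
  case 0
  then show ?case by (simp add: matrix_power_def mat_def)
next
  case (Suc k)
  then show ?case
    by (simp add: matrix_power_def matrix_matrix_mult_def map_matrix_def std_part_sum)
qed

lemma matrix_vector_funpow_eigen:
  fixes M :: "'a :: comm_ring_1 ^ 'n ^ 'n"
  assumes "M *v u = l *s u"
  shows "((*v) M ^^ k) u = l ^ k *s u"
  by (induction k) (simp_all add: matrix_vector_smult assms mult.commute)

section \<open>Oscillation and averaging\<close>

definition oscillation :: "('n :: finite \<Rightarrow> real) \<Rightarrow> real" where
  "oscillation f = Max (range f) - Min (range f)"

lemma diff_le_oscillation: "f i - f j \<le> oscillation f"
  unfolding oscillation_def by (intro diff_mono) auto

lemma abs_diff_le_oscillation: "\<bar>f i - f j\<bar> \<le> oscillation f"
  using diff_le_oscillation[of f i j] diff_le_oscillation[of f j i] by linarith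

lemma oscillation_nonneg: "0 \<le> oscillation f"
  using abs_diff_le_oscillation[of f undefined undefined] by simp

lemma oscillation_leI:
  assumes "\<And>i j. f i - f j \<le> c"
  shows "oscillation f \<le> c"
proof -
  have "Max (range f) \<in> range f" "Min (range f) \<in> range f"
    by (auto intro: Max_in Min_in)
  then show ?thesis unfolding oscillation_def using assms by (metis imageE)
qed

lemma oscillation_add_le: "oscillation (\<lambda>i. f i + g i) \<le> oscillation f + oscillation g"
proof (rule oscillation_leI)
  fix i j
  show "f i + g i - (f j + g j) \<le> oscillation f + oscillation g"
    using diff_le_oscillation[of f i j] diff_le_oscillation[of g i j] by linarith
qed

text \<open>Every row puts weight at least \<open>\<delta>\<close> on an index where
  \<open>f\<close> is minimal, which pulls each average at least \<open>\<delta> * (M - m)\<close>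
  below the maximum \<open>M\<close>, while no average falls below the minimum
  \<open>m\<close>.\<close>

lemma oscillation_stochastic:
  fixes q :: "'n :: finite \<Rightarrow> 'n \<Rightarrow> real"
  assumes rows: "\<And>i. (\<Sum>j\<in>UNIV. q i j) = 1" and lower: "\<And>i j. \<delta> \<le> q i j" and "0 \<le> \<delta>"
  shows "oscillation (\<lambda>i. \<Sum>j\<in>UNIV. q i j * f j) \<le> (1 - \<delta>) * oscillation f"
proof (rule oscillation_leI)
  fix i j
  define M m where "M = Max (range f)" and "m = Min (range f)"
  have q0: "0 \<le> q i j" for i j using lower[of i j] \<open>0 \<le> \<delta>\<close> by linarith
  have M: "f k \<le> M" and m: "m \<le> f k" for k by (auto simp: M_def m_def)
  have "m \<in> range f" unfolding m_def by (intro Min_in) auto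
  then obtain a where a: "f a = m" by auto
  have "\<delta> * (M - m) \<le> q i a * (M - f a)"
    using lower[of i a] M[of a] a by (auto intro: mult_right_mono)
  also have "\<dots> \<le> (\<Sum>k\<in>UNIV. q i k * (M - f k))"
    using M q0 by (intro member_le_sum) auto
  also have "\<dots> = M - (\<Sum>k\<in>UNIV. q i k * f k)"
    using rows[of i] by (simp add: right_diff_distrib sum_subtractf flip: sum_distrib_right)
  finally have 1: "(\<Sum>k\<in>UNIV. q i k * f k) \<le> M - \<delta> * (M - m)" by linarith
  have "0 \<le> (\<Sum>k\<in>UNIV. q j k * (f k - m))"
    using m q0 by (intro sum_nonneg) auto
  also have "\<dots> = (\<Sum>k\<in>UNIV. q j k * f k) - m"
    using rows[of j] by (simp add: right_diff_distrib sum_subtractf flip: sum_distrib_right)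
  finally show "(\<Sum>k\<in>UNIV. q i k * f k) - (\<Sum>k\<in>UNIV. q j k * f k) \<le> (1 - \<delta>) * oscillation f"
    using 1 by (simp add: oscillation_def algebra_simps flip: M_def m_def)
qed

text \<open>Since the weights sum to \<open>1\<close>, \<open>f i\<close> can be moved inside the
  sum, leaving an average of differences \<open>f j - f i\<close>.\<close>

lemma stochastic_diff_le_oscillation:
  fixes q :: "'n :: finite \<Rightarrow> real"
  assumes "(\<Sum>j\<in>UNIV. q j) = 1" and "\<And>j. 0 \<le> q j"
  shows "\<bar>(\<Sum>j\<in>UNIV. q j * f j) - f i\<bar> \<le> oscillation f"
proof -
  have "(\<Sum>j\<in>UNIV. q j * f j) - f i = (\<Sum>j\<in>UNIV. q j * (f j - f i))"
    using assms(1) by (simp add: right_diff_distrib sum_subtractf flip: sum_distrib_right)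
  also have "\<bar>\<dots>\<bar> \<le> (\<Sum>j\<in>UNIV. q j * oscillation f)"
    using assms(2) abs_diff_le_oscillation[of f]
    by (intro order_trans[OF sum_abs] sum_mono) (auto simp: abs_mult intro: mult_left_mono)
  also have "\<dots> = oscillation f" using assms(1) by (simp flip: sum_distrib_right)
  finally show ?thesis .
qed

text \<open>A zero row sum annihilates constants, so \<open>f\<close> may be replaced by
  \<open>f - f i\<close>. Summing over all rows gives a constant independent of
  \<open>i\<close>.\<close>

lemma zero_row_sum_bound:
  fixes e :: "'n :: finite \<Rightarrow> 'n \<Rightarrow> real"
  assumes "\<And>i. (\<Sum>j\<in>UNIV. e i j) = 0"
  shows "\<bar>\<Sum>j\<in>UNIV. e i j * f j\<bar> \<le> (\<Sum>i\<in>UNIV. \<Sum>j\<in>UNIV. \<bar>e i j\<bar>) * oscillation f"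
proof -
  have "(\<Sum>j\<in>UNIV. e i j * f j) = (\<Sum>j\<in>UNIV. e i j * (f j - f i))"
    using assms[of i] by (simp add: right_diff_distrib sum_subtractf flip: sum_distrib_right)
  also have "\<bar>\<dots>\<bar> \<le> (\<Sum>j\<in>UNIV. \<bar>e i j\<bar> * oscillation f)"
    using abs_diff_le_oscillation[of f]
    by (intro order_trans[OF sum_abs] sum_mono) (auto simp: abs_mult intro: mult_left_mono)
  also have "\<dots> = (\<Sum>j\<in>UNIV. \<bar>e i j\<bar>) * oscillation f" by (simp add: sum_distrib_right)
  also have "\<dots> \<le> (\<Sum>i\<in>UNIV. \<Sum>j\<in>UNIV. \<bar>e i j\<bar>) * oscillation f"
    by (intro mult_right_mono oscillation_nonneg
        member_le_sum[of i UNIV "\<lambda>i. \<Sum>j\<in>UNIV. \<bar>e i j\<bar>"]) (auto intro: sum_nonneg)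
  finally show ?thesis .
qed

section \<open>Dual matrices with row sums one\<close>

abbreviation std_osc :: "real dual_number ^ 'n \<Rightarrow> real" where
  "std_osc v \<equiv> oscillation (\<lambda>i. std_part (v $ i))"

abbreviation dual_osc :: "real dual_number ^ 'n \<Rightarrow> real" where
  "dual_osc v \<equiv> oscillation (\<lambda>i. dual_part (v $ i))"

text \<open>The row condition splits: standard parts of a row sum to \<open>1\<close>, dual parts to
  \<open>0\<close>. The dual part of \<open>Q *v v\<close> is thus an average of the dual part of
  \<open>v\<close> plus a coupling term that sees only the oscillation of the standard part. The
  contraction estimates serve a positive block of steps, the displacement estimates a single
  step.\<close>

lemma dual_stochastic_bounds:
  fixes Q :: "real dual_number ^ 'n ^ 'n"
  assumes rows: "Q *v 1 = 1" and lower: "\<And>i j. \<delta> \<le> std_part (Q $ i $ j)" and "0 \<le> \<delta>"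
  obtains C where "0 \<le> C"
    and "\<And>v. std_osc (Q *v v) \<le> (1 - \<delta>) * std_osc v"
    and "\<And>v. dual_osc (Q *v v) \<le> (1 - \<delta>) * dual_osc v + C * std_osc v"
    and "\<And>v i. \<bar>std_part ((Q *v v) $ i) - std_part (v $ i)\<bar> \<le> std_osc v"
    and "\<And>v i. \<bar>dual_part ((Q *v v) $ i) - dual_part (v $ i)\<bar> \<le> dual_osc v + C * std_osc v"
proof -
  define s d where "s i j = std_part (Q $ i $ j)" and "d i j = dual_part (Q $ i $ j)" for i j
  define C where "C = (\<Sum>i\<in>UNIV. \<Sum>j\<in>UNIV. \<bar>d i j\<bar>)"
  have C0: "0 \<le> C" unfolding C_def by (intro sum_nonneg) auto
  have row: "(\<Sum>j\<in>UNIV. Q $ i $ j) = 1" for i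
    using arg_cong[OF rows, of "\<lambda>v. v $ i"] by (simp add: matrix_vector_component)
  have s1: "(\<Sum>j\<in>UNIV. s i j) = 1" and d0: "(\<Sum>j\<in>UNIV. d i j) = 0" for i
    using arg_cong[OF row[of i], of std_part] arg_cong[OF row[of i], of dual_part]
    by (simp_all add: s_def d_def std_part_sum dual_part_sum)
  have ls: "\<delta> \<le> s i j" for i j using lower by (simp add: s_def)
  have s0: "0 \<le> s i j" for i j using ls[of i j] \<open>0 \<le> \<delta>\<close> by linarith
  have std: "std_part ((Q *v v) $ i) = (\<Sum>j\<in>UNIV. s i j * std_part (v $ j))" for v i
    by (simp add: matrix_vector_component std_part_sum s_def)
  have dual: "dual_part ((Q *v v) $ i) =
      (\<Sum>j\<in>UNIV. s i j * dual_part (v $ j)) + (\<Sum>j\<in>UNIV. d i j * std_part (v $ j))" for v i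
    by (simp add: matrix_vector_component dual_part_sum s_def d_def sum.distrib)
  have db: "\<bar>\<Sum>j\<in>UNIV. d i j * f j\<bar> \<le> C * oscillation f" for i f
    unfolding C_def by (rule zero_row_sum_bound[OF d0])
  have dosc: "oscillation (\<lambda>i. \<Sum>j\<in>UNIV. d i j * f j) \<le> 2 * C * oscillation f" for f
  proof (rule oscillation_leI)
    fix i j
    show "(\<Sum>k\<in>UNIV. d i k * f k) - (\<Sum>k\<in>UNIV. d j k * f k) \<le> 2 * C * oscillation f"
      using db[of i f] db[of j f] by linarith
  qed
  show thesis
  \<comment> \<open>The bound on \<open>dual_osc (Q *v v)\<close> compares two rows of the zero-sum
    matrix, each contributing at most \<open>C * std_osc v\<close>.\<close>
  proof (rule that[of "2 * C"])
    show "0 \<le> 2 * C" using C0 by simp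
    show "std_osc (Q *v v) \<le> (1 - \<delta>) * std_osc v" for v
      unfolding std by (rule oscillation_stochastic[OF s1 ls \<open>0 \<le> \<delta>\<close>])
    show "dual_osc (Q *v v) \<le> (1 - \<delta>) * dual_osc v + 2 * C * std_osc v" for v
      unfolding dual
      by (intro order_trans[OF oscillation_add_le] add_mono
          oscillation_stochastic[OF s1 ls \<open>0 \<le> \<delta>\<close>] dosc)
    show "\<bar>std_part ((Q *v v) $ i) - std_part (v $ i)\<bar> \<le> std_osc v" for v i
      unfolding std by (rule stochastic_diff_le_oscillation[OF s1 s0])
    show "\<bar>dual_part ((Q *v v) $ i) - dual_part (v $ i)\<bar> \<le> dual_osc v + 2 * C * std_osc v" for v i
    proof -
      have "0 \<le> C * std_osc v" using C0 by (intro mult_nonneg_nonneg oscillation_nonneg)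
      then show ?thesis
        unfolding dual
        using stochastic_diff_le_oscillation[OF s1[of i] s0, of "\<lambda>j. dual_part (v $ j)" i]
          db[of i "\<lambda>j. std_part (v $ j)"]
        by linarith
    qed
  qed
qed

section \<open>Geometric decay from contraction over blocks of steps\<close>

lemma block_geometric_decay:
  fixes N :: "nat \<Rightarrow> real"
  assumes nonneg: "\<And>k. 0 \<le> N k" and step: "\<And>k. N (k + m) \<le> q * N k"
    and "0 < m" "0 < q" "q < 1"
  obtains C \<eta> where "0 < C" "0 < \<eta>" "\<eta> < 1" "\<And>k. N k \<le> C * \<eta> ^ k"
proof -
  \<comment> \<open>With the \<open>m\<close>-th root, \<open>m\<close> steps contribute exactly the
    factor \<open>q\<close>.\<close>
  define \<eta> where "\<eta> = root m q"
  have \<eta>: "0 < \<eta>" "\<eta> < 1" "\<eta> ^ m = q"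
    using assms by (auto simp: \<eta>_def real_root_lt_1_iff)
  \<comment> \<open>The sum covers the first block \<open>k < m\<close>; all later indices reduce to
    it by steps of \<open>m\<close>. The \<open>1\<close> makes \<open>C\<close> positive even if
    \<open>N\<close> vanishes there.\<close>
  define C where "C = 1 + (\<Sum>j<m. N j / \<eta> ^ j)"
  have "0 < C" unfolding C_def using nonneg \<eta> by (intro add_pos_nonneg sum_nonneg) auto
  moreover have "N k \<le> C * \<eta> ^ k" for k
  proof (induction k rule: less_induct)
    case (less k)
    show ?case
    proof (cases "k < m")
      case True
      then have "N k / \<eta> ^ k \<le> (\<Sum>j<m. N j / \<eta> ^ j)"
        using nonneg \<eta> by (intro member_le_sum) auto
      then have "N k / \<eta> ^ k \<le> C" by (simp add: C_def)
      then show ?thesis using \<eta> by (simp add: pos_divide_le_eq)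
    next
      case False
      have "N k \<le> q * N (k - m)" using step[of "k - m"] False by simp
      also have "\<dots> \<le> q * (C * \<eta> ^ (k - m))"
        using less[of "k - m"] False \<open>0 < m\<close> \<open>0 < q\<close> by (intro mult_left_mono) auto
      also have "\<dots> = C * (\<eta> ^ m * \<eta> ^ (k - m))" using \<eta> by simp
      also have "\<dots> = C * \<eta> ^ k" using False by (simp flip: power_add)
      finally show ?thesis .
    qed
  qed
  ultimately show thesis using that \<eta> by blast
qed

text \<open>In \<open>M * std_osc w + dual_osc w\<close> a large weight \<open>M\<close> absorbs the coupling term \<open>C * std_osc w\<close>.\<close>

lemma dual_oscillation_decay:
  fixes Q :: "real dual_number ^ 'n ^ 'n" and w :: "nat \<Rightarrow> real dual_number ^ 'n"
  assumes rows: "Q *v 1 = 1" and pos: "\<And>i j. 0 < std_part (Q $ i $ j)" and "0 < m"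
    and step: "\<And>k. w (k + m) = Q *v w k"
  obtains C \<eta> where "0 < C" "0 < \<eta>" "\<eta> < 1"
    "\<And>k. std_osc (w k) \<le> C * \<eta> ^ k" "\<And>k. dual_osc (w k) \<le> C * \<eta> ^ k"
proof -
  \<comment> \<open>The cap \<open>1/2\<close> keeps the later factor
    \<open>1 - \<delta> / 2\<close> positive, so that its root can serve as a rate.\<close>
  define \<delta> where "\<delta> = min (1/2) (Min (range (\<lambda>(i, j). std_part (Q $ i $ j))))"
  have "Min (range (\<lambda>(i, j). std_part (Q $ i $ j))) > 0"
    using pos by (subst Min_gr_iff) auto
  then have \<delta>: "0 < \<delta>" "\<delta> \<le> 1/2" by (auto simp: \<delta>_def)
  have lower: "\<delta> \<le> std_part (Q $ i $ j)" for i j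
  proof -
    have "Min (range (\<lambda>(i, j). std_part (Q $ i $ j))) \<le> (\<lambda>(i, j). std_part (Q $ i $ j)) (i, j)"
      by (intro Min_le) auto
    then show ?thesis by (simp add: \<delta>_def)
  qed
  obtain C where C: "0 \<le> C"
    "\<And>v. std_osc (Q *v v) \<le> (1 - \<delta>) * std_osc v"
    "\<And>v. dual_osc (Q *v v) \<le> (1 - \<delta>) * dual_osc v + C * std_osc v"
    using dual_stochastic_bounds[OF rows lower] \<delta>(1) by (metis less_imp_le)
  \<comment> \<open>\<open>2 * C / \<delta>\<close> lets the coupling use up only half of the
    contraction gain \<open>\<delta>\<close>; the \<open>1\<close> ensures that \<open>N\<close>
    dominates \<open>std_osc\<close>.\<close>
  define M where "M = 2 * C / \<delta> + 1"
  have M: "1 \<le> M" using C(1) \<delta> by (simp add: M_def)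
  have CM: "C \<le> \<delta> / 2 * M" using \<delta> by (simp add: M_def field_simps)
  define N where "N k = M * std_osc (w k) + dual_osc (w k)" for k
  have nonneg: "0 \<le> N k" for k
    unfolding N_def using M by (intro add_nonneg_nonneg mult_nonneg_nonneg oscillation_nonneg) auto
  have decay: "N (k + m) \<le> (1 - \<delta> / 2) * N k" for k
  proof -
    let ?s = "std_osc (w k)" and ?d = "dual_osc (w k)"
    have s0: "0 \<le> ?s" and d0: "0 \<le> ?d" by (auto intro: oscillation_nonneg)
    have "N (k + m) \<le> M * ((1 - \<delta>) * ?s) + ((1 - \<delta>) * ?d + C * ?s)"
      unfolding N_def step using M by (intro add_mono mult_left_mono C) auto
    also have "\<dots> \<le> M * ((1 - \<delta>) * ?s) + ((1 - \<delta> / 2) * ?d + \<delta> / 2 * M * ?s)"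
      using CM s0 d0 \<delta> by (intro add_mono mult_right_mono) auto
    also have "\<dots> = (1 - \<delta> / 2) * N k" by (simp add: N_def algebra_simps)
    finally show ?thesis .
  qed
  obtain K \<eta> where K: "0 < K" "0 < \<eta>" "\<eta> < 1" "\<And>k. N k \<le> K * \<eta> ^ k"
    using block_geometric_decay[of N, OF nonneg decay \<open>0 < m\<close>] \<delta> by auto
  have "std_osc (w k) \<le> N k" "dual_osc (w k) \<le> N k" for k
  proof -
    have "std_osc (w k) \<le> M * std_osc (w k)"
      using mult_right_mono[OF M oscillation_nonneg] by simp
    moreover have "0 \<le> std_osc (w k)" "0 \<le> dual_osc (w k)" by (auto intro: oscillation_nonneg)
    ultimately show "std_osc (w k) \<le> N k" "dual_osc (w k) \<le> N k"
      unfolding N_def by linarith+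
  qed
  then show thesis using K that by (meson order_trans)
qed

text \<open>The increments are summed by the closed form of the partial geometric sum. This will
  bound the dual parts of \<open>w\<close>, which the coupling term keeps from being plain averages
  of earlier ones.\<close>

lemma geometric_increments_bounded:
  fixes f :: "nat \<Rightarrow> real"
  assumes "\<And>k. \<bar>f (Suc k) - f k\<bar> \<le> C * \<eta> ^ k" "0 \<le> \<eta>" "\<eta> < 1" "0 \<le> C"
  shows "\<bar>f k\<bar> \<le> \<bar>f 0\<bar> + C / (1 - \<eta>)"
proof -
  have "\<bar>f k\<bar> \<le> \<bar>f 0\<bar> + C * (1 - \<eta> ^ k) / (1 - \<eta>)"
  proof (induction k)
    case (Suc k)
    have "\<bar>f (Suc k)\<bar> \<le> \<bar>f k\<bar> + C * \<eta> ^ k" using assms(1)[of k] by linarith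
    also have "\<dots> \<le> \<bar>f 0\<bar> + C * (1 - \<eta> ^ k) / (1 - \<eta>) + C * \<eta> ^ k" using Suc by linarith
    also have "\<dots> = \<bar>f 0\<bar> + C * (1 - \<eta> ^ Suc k) / (1 - \<eta>)"
      using assms by (simp add: field_simps)
    finally show ?case .
  qed simp
  also have "\<dots> \<le> \<bar>f 0\<bar> + C / (1 - \<eta>)"
    using assms by (intro add_left_mono divide_right_mono mult_left_le) auto
  finally show ?thesis .
qed

section \<open>Conjugation by the diagonal matrix of the eigenvector\<close>

definition rescale_matrix ::
  "'a \<Rightarrow> 'a ^ 'n \<Rightarrow> 'a ^ 'n ^ 'n \<Rightarrow> 'a :: {comm_ring_1, inverse} ^ 'n ^ 'n" where
  "rescale_matrix c u B = (\<chi> i j. c * inverse (u $ i) * B $ i $ j * u $ j)"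

definition rescale_vector :: "'a \<Rightarrow> 'a ^ 'n \<Rightarrow> 'a ^ 'n \<Rightarrow> 'a :: {comm_ring_1, inverse} ^ 'n" where
  "rescale_vector c u y = (\<chi> i. c * inverse (u $ i) * y $ i)"

text \<open>With \<open>D = diag u\<close>, the factors are \<open>c D^-1 B D\<close> and
  \<open>d D^-1 y\<close>, and the inner \<open>D D^-1\<close> cancels. The class
  \<open>inverse\<close> carries no laws, so invertibility of the entries of \<open>u\<close> enters
  as a hypothesis.\<close>

lemma rescale_matrix_vector:
  assumes "\<And>i. inverse (u $ i) * u $ i = 1"
  shows "rescale_matrix c u B *v rescale_vector d u y = rescale_vector (c * d) u (B *v y)"
proof -
  have "c * inverse (u $ i) * B $ i $ j * u $ j * (d * inverse (u $ j) * y $ j) =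
      c * d * inverse (u $ i) * (B $ i $ j * y $ j)" (is "?l = ?r") for i j
  proof -
    have "?l = ?r * (inverse (u $ j) * u $ j)" by (simp only: ac_simps)
    then show ?thesis by (simp add: assms)
  qed
  then show ?thesis
    by (simp add: rescale_matrix_def rescale_vector_def vec_eq_iff matrix_vector_component
        sum_distrib_left)
qed

text \<open>Rescaling turns the eigenvector into the constant vector; this is the source of the unit
  row sums.\<close>

lemma rescale_vector_eigen:
  assumes "\<And>i. inverse (u $ i) * u $ i = 1" "c * d = 1"
  shows "rescale_vector c u (d *s u) = 1"
proof -
  have "c * inverse (u $ i) * (d * u $ i) = 1" (is "?l = _") for i
  proof -
    have "?l = (c * d) * (inverse (u $ i) * u $ i)" by (simp only: ac_simps)
    then show ?thesis using assms by simp
  qed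
  then show ?thesis by (simp add: rescale_vector_def vec_eq_iff)
qed

text \<open>Each quotient is compared with \<open>l\<close> itself, so the gap between any two
  follows by the triangle inequality. The iterates are not normalized here; positivity of their
  standard parts is exported so that a scaling can be cancelled later.\<close>

lemma collatz_quotient_convergence:
  fixes A :: "real dual_number ^ 'n ^ 'n" and u z :: "real dual_number ^ 'n"
  assumes eig: "A *v u = l *s u" and u: "\<And>i. 0 < std_part (u $ i)" and l: "0 < std_part l"
    and A: "\<And>i j. 0 \<le> std_part (A $ i $ j)"
    and "0 < m" and Am: "\<And>i j. 0 < std_part ((((**) A) ^^ m) (mat 1) $ i $ j)"
    and z: "\<And>i. 0 < std_part (z $ i)"
  obtains C \<eta> where "0 < C" "0 < \<eta>" "\<eta> < 1"
    "\<And>k i. 0 < std_part (((*v) A ^^ k) z $ i)"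
    "\<And>k i. \<bar>std_part ((A *v ((*v) A ^^ k) z) $ i / ((*v) A ^^ k) z $ i - l)\<bar> \<le> C * \<eta> ^ k"
    "\<And>k i. \<bar>dual_part ((A *v ((*v) A ^^ k) z) $ i / ((*v) A ^^ k) z $ i - l)\<bar> \<le> C * \<eta> ^ k"
proof -
  define c where "c = inverse l"
  have cl: "c * l = 1" using l dual_inverse_mult[of l] by (simp add: c_def)
  have clk: "c ^ k * l ^ k = 1" for k by (simp add: cl flip: power_mult_distrib)
  have sc: "0 < std_part c" using l by (simp add: c_def)
  have iu: "inverse (u $ i) * u $ i = 1" for i using u[of i] by (intro dual_inverse_mult) auto
  define w where "w k = rescale_vector (c ^ k) u (((*v) A ^^ k) z)" for k
  define Q where "Q k = rescale_matrix (c ^ k) u ((((**) A) ^^ k) (mat 1))" for k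
  have Q: "Q j *v w k = w (j + k)" for j k
    unfolding Q_def w_def rescale_matrix_vector[OF iu] matrix_vector_funpow
    by (simp add: power_add funpow_add)
  \<comment> \<open>The constant vector is the rescaled \<open>u\<close>, and the factor
    \<open>c ^ k\<close> offsets the growth \<open>l ^ k\<close> of \<open>u\<close> under
    \<open>k\<close> steps.\<close>
  have rows: "Q k *v 1 = 1" for k
  proof -
    have "(1 :: real dual_number ^ 'n) = rescale_vector 1 u (1 *s u)"
      by (rule rescale_vector_eigen[symmetric, OF iu]) simp
    then have "Q k *v 1 = rescale_vector (c ^ k) u (l ^ k *s u)"
      unfolding Q_def using rescale_matrix_vector[OF iu, of "c ^ k" _ 1 u]
      by (simp add: matrix_vector_funpow matrix_vector_funpow_eigen[OF eig])
    then show ?thesis using rescale_vector_eigen[OF iu clk] by simp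
  qed
  have Qm: "0 < std_part (Q m $ i $ j)" for i j
    unfolding Q_def rescale_matrix_def using sc u Am[of i j]
    by (auto simp: std_part_power)
  have Q1: "0 \<le> std_part (Q 1 $ i $ j)" for i j
    unfolding Q_def rescale_matrix_def using sc u[of i] u[of j] A[of i j]
    by (auto simp: std_part_power)
  have Qs: "Q 1 *v w k = w (Suc k)" for k using Q[of 1 k] by simp
  have step: "w (k + m) = Q m *v w k" for k by (simp add: Q add.commute)
  obtain K \<eta> where K: "0 < K" "0 < \<eta>" "\<eta> < 1"
    "\<And>k. std_osc (w k) \<le> K * \<eta> ^ k" "\<And>k. dual_osc (w k) \<le> K * \<eta> ^ k"
    using dual_oscillation_decay[of "Q m" m w, OF rows Qm \<open>0 < m\<close> step] by blast
  \<comment> \<open>A single step is only known to be nonnegative, hence the lower bound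
    \<open>0\<close>: no contraction, but the displacement estimates apply.\<close>
  obtain L where L: "0 \<le> L"
    "\<And>v i. \<bar>std_part ((Q 1 *v v) $ i) - std_part (v $ i)\<bar> \<le> std_osc v"
    "\<And>v i. \<bar>dual_part ((Q 1 *v v) $ i) - dual_part (v $ i)\<bar> \<le> dual_osc v + L * std_osc v"
    using dual_stochastic_bounds[of "Q 1" 0, OF rows Q1] by (metis order_refl)
  \<comment> \<open>\<open>K\<close> bounds the standard increments and \<open>K + L * K\<close> the
    dual ones, so \<open>T\<close> serves both.\<close>
  define T where "T = K + L * K"
  have T0: "0 < T" unfolding T_def using K L by (simp add: add_pos_nonneg)
  have es: "\<bar>std_part (w (Suc k) $ i - w k $ i)\<bar> \<le> T * \<eta> ^ k" for k i
  proof -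
    have "\<bar>std_part (w (Suc k) $ i - w k $ i)\<bar> \<le> K * \<eta> ^ k"
      using L(2)[of "w k" i] K(4)[of k] by (simp add: Qs del: One_nat_def)
    also have "\<dots> \<le> T * \<eta> ^ k" using K L by (intro mult_right_mono) (auto simp: T_def)
    finally show ?thesis .
  qed
  have ed: "\<bar>dual_part (w (Suc k) $ i - w k $ i)\<bar> \<le> T * \<eta> ^ k" for k i
  proof -
    have "\<bar>dual_part (w (Suc k) $ i - w k $ i)\<bar> \<le> dual_osc (w k) + L * std_osc (w k)"
      using L(3)[of "w k" i] by (simp add: Qs del: One_nat_def)
    also have "\<dots> \<le> K * \<eta> ^ k + L * (K * \<eta> ^ k)"
      using K L by (intro add_mono mult_left_mono) auto
    finally show ?thesis by (simp add: T_def algebra_simps)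
  qed
  \<comment> \<open>Averaging never goes below the initial minimum, so the denominators stay away
    from zero.\<close>
  define \<mu> where "\<mu> = Min (range (\<lambda>i. std_part (w 0 $ i)))"
  have \<mu>: "0 < \<mu>" unfolding \<mu>_def using u z
    by (subst Min_gr_iff) (auto simp: w_def rescale_vector_def)
  have w\<mu>: "\<mu> \<le> std_part (w k $ i)" for k i
  proof (induction k arbitrary: i)
    case 0
    then show ?case by (simp add: \<mu>_def)
  next
    case (Suc k)
    have r: "(\<Sum>j\<in>UNIV. std_part (Q 1 $ i $ j)) = 1"
      using arg_cong[OF rows[of 1], of "\<lambda>v. std_part (v $ i)"]
      by (simp add: matrix_vector_component std_part_sum)
    have "\<mu> = (\<Sum>j\<in>UNIV. std_part (Q 1 $ i $ j) * \<mu>)" using r by (simp flip: sum_distrib_right)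
    also have "\<dots> \<le> (\<Sum>j\<in>UNIV. std_part (Q 1 $ i $ j) * std_part (w k $ j))"
      using Suc Q1 by (intro sum_mono mult_left_mono) auto
    also have "\<dots> = std_part (w (Suc k) $ i)"
      by (simp add: matrix_vector_component std_part_sum flip: Qs)
    finally show ?case .
  qed
  define B where "B = Max (range (\<lambda>i. \<bar>dual_part (w 0 $ i)\<bar>)) + T / (1 - \<eta>)"
  have wB: "\<bar>dual_part (w k $ i)\<bar> \<le> B" for k i
  proof -
    have "\<bar>dual_part (w k $ i)\<bar> \<le> \<bar>dual_part (w 0 $ i)\<bar> + T / (1 - \<eta>)"
      using geometric_increments_bounded[of "\<lambda>k. dual_part (w k $ i)" T \<eta> k] ed[of _ i] K T0
      by simp
    also have "\<dots> \<le> B" unfolding B_def by (intro add_right_mono Max_ge) auto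
    finally show ?thesis .
  qed
  have B0: "0 \<le> B" using wB[of 0 undefined] by linarith
  have iter: "((*v) A ^^ k) z $ i = l ^ k * u $ i * w k $ i" for k i
  proof -
    have "l ^ k * u $ i * w k $ i = (c ^ k * l ^ k) * (inverse (u $ i) * u $ i) * ((*v) A ^^ k) z $ i"
      unfolding w_def rescale_vector_def vec_lambda_beta by (simp only: ac_simps)
    then show ?thesis by (simp add: clk iu)
  qed
  have pos: "0 < std_part (((*v) A ^^ k) z $ i)" for k i
    unfolding iter using l u[of i] w\<mu>[of k i] \<mu> by (auto simp: std_part_power)
  \<comment> \<open>By \<open>iter\<close>, numerator and denominator share the factor
    \<open>l ^ k * u $ i\<close>; what remains is \<open>l\<close> times the quotient of consecutive
    \<open>w\<close>.\<close>
  have quot: "(A *v ((*v) A ^^ k) z) $ i / ((*v) A ^^ k) z $ i - l =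
      l * ((w (Suc k) $ i - w k $ i) / w k $ i)" for k i
  proof -
    have wk: "(w (Suc k) $ i - w k $ i) / w k $ i * w k $ i = w (Suc k) $ i - w k $ i" (is "?e * _ = _")
      using w\<mu>[of k i] \<mu> by (intro dual_number_divide_mult) auto
    have "(A *v ((*v) A ^^ k) z) $ i = l ^ Suc k * u $ i * w (Suc k) $ i"
      using iter[of "Suc k" i] by simp
    also have "\<dots> = l ^ Suc k * u $ i * (?e * w k $ i + w k $ i)" by (simp add: wk)
    also have "\<dots> = (l + l * ?e) * (l ^ k * u $ i * w k $ i)" by (simp add: algebra_simps)
    finally have "(A *v ((*v) A ^^ k) z) $ i / ((*v) A ^^ k) z $ i = l + l * ?e"
      using pos[of k i] unfolding iter[symmetric] by (intro dual_divide_eqI) auto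
    then show ?thesis by simp
  qed
  define a b where "a = \<bar>std_part l\<bar> / \<mu>"
    and "b = \<bar>std_part l\<bar> * (1 / \<mu> + B / \<mu>\<^sup>2) + \<bar>dual_part l\<bar> / \<mu>"
  have ab: "0 \<le> a" "0 \<le> b" using \<mu> B0 by (simp_all add: a_def b_def)
  have bnd: "\<bar>std_part (l * ((w (Suc k) $ i - w k $ i) / w k $ i))\<bar> \<le> a * (T * \<eta> ^ k)"
     "\<bar>dual_part (l * ((w (Suc k) $ i - w k $ i) / w k $ i))\<bar> \<le> b * (T * \<eta> ^ k)" for k i
    unfolding a_def b_def by (rule dual_mult_divide_bounds[OF es ed w\<mu> \<mu> wB])+
  have le: "a * (T * \<eta> ^ k) \<le> (a + b + 1) * T * \<eta> ^ k" "b * (T * \<eta> ^ k) \<le> (a + b + 1) * T * \<eta> ^ k" for k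
    using ab T0 K(2) by (auto simp: mult.assoc intro!: mult_right_mono)
  show thesis
  \<comment> \<open>\<open>a\<close> and \<open>b\<close> are only known to be nonnegative; adding
    \<open>1\<close> makes the common constant positive.\<close>
  proof (rule that[of "(a + b + 1) * T" \<eta>])
    show "0 < (a + b + 1) * T" using ab T0 by simp
  qed (use K pos quot bnd le order_trans in \<open>metis+\<close>)
qed

section \<open>Descent to real eigenvectors and their positivity\<close>

lemma dual_complex_simps:
  "dual_complex (a * b) = dual_complex a * dual_complex b"
  "dual_complex (a + b) = dual_complex a + dual_complex b"
  "dual_complex 0 = 0"
  "dual_complex a = dual_complex b \<longleftrightarrow> a = b"
  by (cases a; cases b; simp add: times_dual_number_def plus_dual_number_def zero_dual_number_def)+

lemma dual_complex_sum: "dual_complex (sum f S) = (\<Sum>i\<in>S. dual_complex (f i))"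
  by (induction S rule: infinite_finite_induct) (auto simp: dual_complex_simps)

text \<open>The embedding into dual complex numbers is an injective ring homomorphism, so the
  eigenvector equation descends entry by entry.\<close>

lemma dual_eigenpair_realD:
  assumes "dual_eigenpair A (dual_complex l) (map_vector dual_complex x)"
  shows "A *v x = l *s x" and "map_vector std_part x \<noteq> 0"
proof -
  have "dual_complex ((A *v x) $ i) = dual_complex ((l *s x) $ i)" for i
    using assms
    by (auto simp: dual_eigenpair_def vec_eq_iff matrix_vector_component map_vector_def
        map_matrix_def dual_complex_sum dual_complex_simps)
  then show "A *v x = l *s x" unfolding vec_eq_iff dual_complex_simps by blast
  show "map_vector std_part x \<noteq> 0"
    using assms by (auto simp: dual_eigenpair_def vec_eq_iff map_vector_def dual_number.map_sel)
qed

text \<open>A dual number that is positive lexicographically may have standard part zero. Applying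
  the positive \<open>A ^ m\<close> to a nonzero nonnegative standard part makes every entry
  \<open>l ^ m * u $ i\<close> strictly positive there, which forces both factors to be
  positive.\<close>

lemma primitive_eigenvector_positive:
  fixes A :: "real dual_number ^ 'n ^ 'n"
  assumes eig: "A *v u = l *s u" and u: "\<And>i. 0 \<le> std_part (u $ i)" "map_vector std_part u \<noteq> 0"
    and "0 \<le> std_part l"
    and "0 < m" and Am: "\<And>i j. 0 < std_part ((((**) A) ^^ m) (mat 1) $ i $ j)"
  shows "0 < std_part l" and "0 < std_part (u $ i)"
proof -
  obtain a where a: "std_part (u $ a) \<noteq> 0"
    using u(2) by (auto simp: vec_eq_iff map_vector_def)
  have *: "0 < std_part l ^ m * std_part (u $ i)" for i
  proof -
    have "0 < std_part ((((**) A) ^^ m) (mat 1) $ i $ a) * std_part (u $ a)"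
      using Am[of i a] u(1)[of a] a by auto
    also have "\<dots> \<le> (\<Sum>j\<in>UNIV. std_part ((((**) A) ^^ m) (mat 1) $ i $ j) * std_part (u $ j))"
      using less_imp_le[OF Am] u(1) by (intro member_le_sum) auto
    also have "\<dots> = std_part (((((**) A) ^^ m) (mat 1) *v u) $ i)"
      by (simp add: matrix_vector_component std_part_sum)
    also have "\<dots> = std_part l ^ m * std_part (u $ i)"
      by (simp add: matrix_vector_funpow matrix_vector_funpow_eigen[OF eig] std_part_power)
    finally show ?thesis .
  qed
  \<comment> \<open>Here \<open>0 < m\<close> matters: it gives \<open>0 ^ m = 0\<close>, which
    excludes a zero standard part of \<open>l\<close>.\<close>
  show "0 < std_part l" using *[of a] assms(4) \<open>0 < m\<close> by (cases "std_part l = 0") (auto simp: zero_power)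
  show "0 < std_part (u $ i)" using *[of i] u(1)[of i] by (cases "std_part (u $ i) = 0") auto
qed

section \<open>Normalization as scaling\<close>

lemma dual_normalize_eq: "dual_normalize v = inverse (dual_norm v) *s v"
  by (simp add: dual_normalize_def vec_eq_iff dual_divide_inverse mult.commute)

lemma std_part_dual_norm_pos:
  assumes "0 < std_part (v $ i)"
  shows "0 < std_part (dual_norm v)"
proof -
  have "map_vector std_part v $ i \<noteq> 0 $ i" using assms by (simp add: map_vector_def)
  then show ?thesis by (auto simp: dual_norm_def Let_def)
qed

lemma dual_quotient_scale:
  fixes a b s :: "'a :: field dual_number"
  assumes "std_part s \<noteq> 0" "std_part b \<noteq> 0"
  shows "(s * a) / (s * b) = a / b"
proof (rule dual_divide_eqI)
  show "s * a = a / b * (s * b)"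
    using dual_number_divide_mult[OF assms(2), of a] by (metis mult.left_commute)
qed (use assms in simp)

text \<open>Each normalization multiplies by the inverse of a norm with positive standard part. The
  accumulated scalar stays invertible and so cancels in the Collatz quotients.\<close>

lemma power_iteration_scaled:
  fixes A :: "real dual_number ^ 'n ^ 'n"
  assumes pos: "\<And>k i. 0 < std_part (((*v) A ^^ k) (x 0) $ i)"
    and step: "\<And>k. x (Suc k) = dual_normalize (A *v x k)"
  shows "\<exists>s. 0 < std_part s \<and> x k = s *s ((*v) A ^^ k) (x 0)"
proof (induction k)
  case 0
  show ?case by (rule exI[of _ 1]) simp
next
  case (Suc k)
  then obtain s where s: "0 < std_part s" "x k = s *s ((*v) A ^^ k) (x 0)" by blast
  then have Ax: "A *v x k = s *s ((*v) A ^^ Suc k) (x 0)" by (simp add: matrix_vector_smult)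
  have "0 < std_part ((A *v x k) $ i)" for i
    using pos[of "Suc k" i] s(1) unfolding Ax by simp
  then have "0 < std_part (inverse (dual_norm (A *v x k)) * s)"
    using std_part_dual_norm_pos[of "A *v x k"] s(1) by simp
  moreover have "x (Suc k) = (inverse (dual_norm (A *v x k)) * s) *s ((*v) A ^^ Suc k) (x 0)"
    \<comment> \<open>Only the occurrence outside the norm is rewritten; the norm remains part of
      the scalar.\<close>
    unfolding step dual_normalize_eq by (subst (2) Ax) (simp add: vector_smult_assoc)
  ultimately show ?case by blast
qed

section \<open>Decay of the gap between the Collatz bounds\<close>

theorem theorem3:
  fixes A :: "real dual_number ^ 'n ^ 'n"
    and l :: "real dual_number"
    and x0 :: "real ^ 'n"
    and x y :: "nat \<Rightarrow> real dual_number ^ 'n"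
    and lo hi :: "nat \<Rightarrow> real dual_number"
  assumes "dual_primitive_matrix A"
    and "dual_perron_eigenvalue A l"
    and "\<forall>i. 0 < x0 $ i"
    and "x 0 = map_vector (\<lambda>r. Dual r 0) x0"
    and "y 0 = A *v x 0"
    and "\<forall>k. x (Suc k) = dual_normalize (y k)"
    and "\<forall>k. y (Suc k) = A *v x (Suc k)"
    and "\<forall>k. lo k = collatz_lower A (x k)"
    and "\<forall>k. hi k = collatz_upper A (x k)"
  shows "dual_tendsto (\<lambda>k. hi k - lo k) 0 \<and>
    (\<exists>\<Delta> \<eta> :: real. 0 < \<Delta> \<and> 0 < \<eta> \<and> \<eta> < 1 \<and>
      (\<forall>\<^sub>F k in sequentially.
        \<bar>std_part (hi k - lo k)\<bar> \<le> \<Delta> * \<eta> ^ k \<and>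
        \<bar>dual_part (hi k - lo k)\<bar> \<le> \<Delta> * \<eta> ^ k))"
proof -
  have A: "0 \<le> std_part (A $ i $ j)" for i j
    using assms(1) by (auto simp: dual_primitive_matrix_def primitive_matrix_def map_matrix_def)
  obtain m where m: "0 < m" "\<And>i j. 0 < std_part ((((**) A) ^^ m) (mat 1) $ i $ j)"
    using assms(1) unfolding dual_primitive_matrix_def primitive_matrix_def std_part_matrix_power
    by blast
  obtain u where u: "\<And>i. 0 < u $ i" "A *v u = l *s u" "map_vector std_part u \<noteq> 0"
    using assms(2) dual_eigenpair_realD unfolding dual_perron_eigenvalue_def by blast
  have l0: "0 \<le> std_part l"
    using assms(2) by (auto simp: dual_perron_eigenvalue_def less_dual_number_def)
  have u0: "0 \<le> std_part (u $ i)" for i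
    using u(1)[of i] by (auto simp: less_dual_number_def)
  note pos = primitive_eigenvector_positive[OF u(2) u0 u(3) l0 m]
  have z: "0 < std_part (x 0 $ i)" for i using assms(3,4) by (simp add: map_vector_def)
  obtain C \<eta> where C: "0 < C" "0 < \<eta>" "\<eta> < 1"
    and itpos: "\<And>k i. 0 < std_part (((*v) A ^^ k) (x 0) $ i)"
    and quot: "\<And>k i. \<bar>std_part ((A *v ((*v) A ^^ k) (x 0)) $ i / ((*v) A ^^ k) (x 0) $ i - l)\<bar>
        \<le> C * \<eta> ^ k"
      "\<And>k i. \<bar>dual_part ((A *v ((*v) A ^^ k) (x 0)) $ i / ((*v) A ^^ k) (x 0) $ i - l)\<bar>
        \<le> C * \<eta> ^ k"
    using collatz_quotient_convergence[OF u(2) pos(2) pos(1) A m z] by blast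
  have y: "y k = A *v x k" for k using assms(5,7) by (cases k) auto
  have quot_eq: "(A *v x k) $ i / x k $ i =
      (A *v ((*v) A ^^ k) (x 0)) $ i / ((*v) A ^^ k) (x 0) $ i" for k i
  proof -
    obtain s where s: "0 < std_part s" "x k = s *s ((*v) A ^^ k) (x 0)"
      using power_iteration_scaled[of A x k, OF itpos] assms(6) y by auto
    show ?thesis
      unfolding s(2) matrix_vector_smult unfolding vector_smult_component
      using s(1) itpos[of k i] by (intro dual_quotient_scale) auto
  qed
  \<comment> \<open>Minimum and maximum over finitely many indices are attained, so both bounds are
    actual quotients.\<close>
  have hi: "hi k \<in> range (\<lambda>i. (A *v x k) $ i / x k $ i)"
    and lo: "lo k \<in> range (\<lambda>i. (A *v x k) $ i / x k $ i)" for k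
    using assms(8,9) by (auto simp: collatz_lower_def collatz_upper_def intro!: Max_in Min_in)
  \<comment> \<open>Both quotients lie within \<open>C * \<eta> ^ k\<close> of \<open>l\<close> in
    each part, whence the factor \<open>2\<close>.\<close>
  have bound: "\<bar>std_part (hi k - lo k)\<bar> \<le> 2 * C * \<eta> ^ k"
    "\<bar>dual_part (hi k - lo k)\<bar> \<le> 2 * C * \<eta> ^ k" for k
  proof -
    obtain i j where ij: "hi k = (A *v x k) $ i / x k $ i" "lo k = (A *v x k) $ j / x k $ j"
      using hi lo by blast
    show "\<bar>std_part (hi k - lo k)\<bar> \<le> 2 * C * \<eta> ^ k" "\<bar>dual_part (hi k - lo k)\<bar> \<le> 2 * C * \<eta> ^ k"
      using quot(1)[of k i] quot(1)[of k j] quot(2)[of k i] quot(2)[of k j]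
      unfolding ij quot_eq std_part_simps dual_part_simps by linarith+
  qed
  have lim: "(\<lambda>k. 2 * C * \<eta> ^ k) \<longlonglongrightarrow> 0"
    using C by (intro tendsto_mult_right_zero LIMSEQ_realpow_zero) auto
  have "dual_tendsto (\<lambda>k. hi k - lo k) 0"
    unfolding dual_tendsto_def std_part_simps(1) dual_part_simps(1)
    by (intro conjI tendsto_0_le[OF lim, where K = 1] always_eventually allI)
      (use bound C in \<open>auto simp del: std_part_simps dual_part_simps simp: abs_of_pos\<close>)
  moreover have "\<exists>\<Delta> \<eta> :: real. 0 < \<Delta> \<and> 0 < \<eta> \<and> \<eta> < 1 \<and>
      (\<forall>\<^sub>F k in sequentially.
        \<bar>std_part (hi k - lo k)\<bar> \<le> \<Delta> * \<eta> ^ k \<and> \<bar>dual_part (hi k - lo k)\<bar> \<le> \<Delta> * \<eta> ^ k)"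
    using C bound by (intro exI[of _ "2 * C"] exI[of _ \<eta>]) auto
  ultimately show ?thesis by blast
qed

end
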